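(* For all positive integers $k$ and $t$, $$\frac{\prod_{n=1}^t \binom{2kn}{kn}}{\prod_{n=1}^t \binom{2n}{n}}\in\mathbb{Z},\qquad \frac{\prod_{n=1}^t \binom{3kn}{kn,kn,kn}}{\prod_{n=1}^t \binom{3n}{n,n,n}}\in\mathbb{Z},\qquad \frac{\prod_{n=1}^t \binom{6kn}{kn,2kn,3kn}}{\prod_{n=1}^t \binom{6n}{n,2n,3n}}\in\mathbb{Z}.$$
   Context: For nonnegative integers $b_1,\dots,b_s$ with sum $b$, $\binom{b}{b_1,\dots,b_s}=\frac{b!}{b_1!\cdots b_s!}$ denotes the multinomial coefficient. *)

theory Defs
  imports Complex_Main
begin

(* The upper entry b of the multinomial coefficient is always the sum of the lower
   entries, so it is not a separate argument.  The value is the exact rational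
   quotient, so no truncating division is involved. *)
definition multinomial :: "nat list \<Rightarrow> rat" where
  "multinomial bs = fact (sum_list bs) / prod_list (map fact bs)"

lemma multinomial_two: "multinomial [a, b] = of_nat ((a + b) choose a)"
  by (simp add: multinomial_def binomial_fact)

end

theory Submission
  imports Defs "HOL-Number_Theory.Cong"
begin

text \<open>
  The exponent of a prime \<open>p\<close> in a multinomial coefficient with lower entries
  \<open>c\<^sub>1 n, c\<^sub>2 n, \<dots>\<close> is, by Legendre's formula, the sum over the powers \<open>m = p\<^sup>i\<close> of
  \<open>\<phi>(n/m)\<close>, where \<open>\<phi>(x) = \<lfloor>(c\<^sub>1 + c\<^sub>2 + \<dots>) x\<rfloor> - \<lfloor>c\<^sub>1 x\<rfloor> - \<lfloor>c\<^sub>2 x\<rfloor> - \<dots>\<close> has period 1.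
  In the three cases at hand \<open>\<phi>\<close> is nondecreasing on \<open>[0,1)\<close>. The exponent does not change when
  \<open>n\<close> is multiplied by \<open>p\<close>, so one may assume that \<open>p\<close> does not divide \<open>k\<close>. Then
  \<open>n \<mapsto> k n\<close> permutes the residues modulo \<open>m\<close>, and among all sets of \<open>r\<close> residues the initial segment
  \<open>{0, \<dots>, r - 1}\<close> minimises the sum of a nondecreasing function.
\<close>

section \<open>Legendre's formula for prime exponents of factorials\<close>

text \<open>From \<open>n\<close> to \<open>Suc n\<close> the quotient by \<open>p ^ i\<close> grows
  by 1 exactly when \<open>p ^ i\<close> divides \<open>Suc n\<close>, and the number of such
  \<open>i \<ge> 1\<close> is the multiplicity. The free bound \<open>L\<close> lets several
  factorials share one range of summation.\<close>

lemma multiplicity_fact_legendre: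
  fixes p :: nat
  assumes p: "prime p" and "n \<le> L"
  shows "multiplicity p (fact n :: nat) = (\<Sum>i=1..L. n div p ^ i)"
  using \<open>n \<le> L\<close>
proof (induction n)
  case (Suc n)
  have p1: "p > 1"
    using p by (rule prime_gt_1_nat)
  define v where "v = multiplicity p (Suc n)"
  have dvd_iff: "p ^ i dvd Suc n \<longleftrightarrow> i \<le> v" for i
    unfolding v_def using p1 by (intro power_dvd_iff_le_multiplicity) auto
  \<comment> \<open>The bound obtained here puts every \<open>i \<ge> 1\<close> with
    \<open>p ^ i dvd Suc n\<close> inside the range up to \<open>L\<close>.\<close>
  have "v < p ^ v"
    using p1 by (intro power_gt_expt) auto
  also have "p ^ v \<le> Suc n"
    using dvd_iff[of v] by (intro dvd_imp_le) auto
  finally have "v \<le> L"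
    using Suc.prems by simp
  hence "{i\<in>{1..L}. i \<le> v} = {1..v}"
    by auto
  hence "v = (\<Sum>i\<in>{i\<in>{1..L}. i \<le> v}. 1)"
    by simp
  also have "\<dots> = (\<Sum>i=1..L. if p ^ i dvd Suc n then 1 else 0)"
    by (subst sum.inter_filter) (auto simp: dvd_iff)
  finally have v_eq: "v = (\<Sum>i=1..L. if p ^ i dvd Suc n then 1 else 0)" .
  have "multiplicity p (fact (Suc n) :: nat) = v + multiplicity p (fact n :: nat)"
    using p by (simp only: fact_Suc of_nat_id v_def)
      (subst prime_elem_multiplicity_mult_distrib, auto)
  also have "\<dots> = (\<Sum>i=1..L. (if p ^ i dvd Suc n then 1 else 0) + n div p ^ i)"
    using Suc v_eq by (simp add: sum.distrib)
  also have "\<dots> = (\<Sum>i=1..L. Suc n div p ^ i)"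
    by (intro sum.cong) (auto simp: div_Suc dvd_eq_mod_eq_0)
  finally show ?case .
qed simp

text \<open>Since \<open>p * n div p ^ Suc i = n div p ^ i\<close>, Legendre's sum shifts by one
  index, and the new term at \<open>i = 0\<close> contributes \<open>n\<close>.\<close>

lemma multiplicity_fact_prime_mult:
  fixes p :: nat
  assumes p: "prime p"
  shows "multiplicity p (fact (p * n) :: nat) = n + multiplicity p (fact n :: nat)"
proof -
  have p0: "p > 0"
    using p by (rule prime_gt_0_nat)
  have "n \<le> p * n"
    using p0 by simp
  have "multiplicity p (fact (p * n) :: nat) = (\<Sum>i=1..Suc (p * n). p * n div p ^ i)"
    using p by (intro multiplicity_fact_legendre) auto
  also have "\<dots> = (\<Sum>i=0..p * n. p * n div p ^ Suc i)"
    by (simp only: One_nat_def sum.shift_bounds_cl_Suc_ivl)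
  also have "\<dots> = (\<Sum>i=0..p * n. n div p ^ i)"
    using p0 by simp
  also have "\<dots> = n + (\<Sum>i=1..p * n. n div p ^ i)"
    by (simp add: sum.atLeast_Suc_atMost)
  also have "(\<Sum>i=1..p * n. n div p ^ i) = multiplicity p (fact n :: nat)"
    using multiplicity_fact_legendre[OF p \<open>n \<le> p * n\<close>] by simp
  finally show ?thesis .
qed

lemma multiplicity_prod_list:
  fixes p :: nat
  assumes "prime p" and "\<And>x. x \<in> set xs \<Longrightarrow> f x \<noteq> 0"
  shows "multiplicity p (\<Prod>x\<leftarrow>xs. f x :: nat) = (\<Sum>x\<leftarrow>xs. multiplicity p (f x))"
  using assms(2)
proof (induction xs)
  case (Cons a xs)
  hence nz: "f a \<noteq> 0" "\<And>x. x \<in> set xs \<Longrightarrow> f x \<noteq> 0"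
    by simp_all
  hence "0 \<notin> f ` set xs"
    by (metis imageE)
  hence "(\<Prod>x\<leftarrow>xs. f x) \<noteq> 0"
    by (simp add: prod_list_zero_iff)
  thus ?case
    using Cons.IH nz assms(1) by (simp add: prime_elem_multiplicity_mult_distrib)
qed simp

section \<open>Sums of monotone and periodic functions over residues\<close>

text \<open>The largest element \<open>a\<close> of a set of \<open>r + 1\<close> naturals is at
  least \<open>r\<close>, so \<open>f r \<le> f a\<close>; induction handles the set without
  \<open>a\<close>.\<close>

lemma sum_lessThan_card_le:
  fixes f :: "nat \<Rightarrow> int"
  assumes mono: "mono_on {..<m} f" and "A \<subseteq> {..<m}"
  shows "(\<Sum>i<card A. f i) \<le> (\<Sum>i\<in>A. f i)"
  using \<open>A \<subseteq> {..<m}\<close>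
proof (induction "card A" arbitrary: A)
  case 0
  moreover have "finite A"
    by (rule finite_subset[OF "0.prems"]) simp
  ultimately show ?case
    by simp
next
  case (Suc r)
  have fin: "finite A" and "A \<noteq> {}"
    using Suc.hyps by (auto intro: card_ge_0_finite)
  define a where "a = Max A"
  have a: "a \<in> A"
    unfolding a_def using fin \<open>A \<noteq> {}\<close> by simp
  have "A \<subseteq> {..a}"
    unfolding a_def using fin by auto
  hence "card A \<le> Suc a"
    using card_mono[of "{..a}" A] by simp
  hence "f r \<le> f a"
    using a Suc.prems Suc.hyps by (intro mono_onD[OF mono]) auto
  moreover have "(\<Sum>i<r. f i) \<le> (\<Sum>i\<in>A - {a}. f i)"
    using Suc.hyps(1)[of "A - {a}"] Suc.hyps(2)[symmetric] Suc.prems a fin by auto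
  ultimately show ?case
    using Suc.hyps(2)[symmetric] sum.remove[OF fin a, of f] by simp
qed

text \<open>For \<open>t \<le> m\<close> the residues of \<open>k * n\<close> with
  \<open>n < t\<close> are distinct, so the bound for sets of residues applies. For larger
  \<open>t\<close> a full period of \<open>m\<close> terms is split off, and periodicity reduces the
  rest to the claim for \<open>t - m\<close>.\<close>

lemma sum_periodic_mono_le:
  fixes f :: "nat \<Rightarrow> int"
  assumes mono: "mono_on {..<m} f" and periodic: "\<And>n. f (n mod m) = f n"
    and cop: "coprime k m" and "m > 0"
  shows "(\<Sum>n<t. f n) \<le> (\<Sum>n<t. f (k * n))"
proof (induction t rule: less_induct)
  case (less t)
  have short: "(\<Sum>n<t. f n) \<le> (\<Sum>n<t. f (k * n))" if "t \<le> m" for t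
  proof -
    define g where "g n = k * n mod m" for n
    have "inj_on g {..<t}"
    proof (rule inj_onI)
      fix x y assume "x \<in> {..<t}" "y \<in> {..<t}" "g x = g y"
      thus "x = y"
        using cop that cong_mult_lcancel_nat[of k m x y]
        by (auto simp: g_def cong_def)
    qed
    hence "card (g ` {..<t}) = t" and "(\<Sum>i\<in>g ` {..<t}. f i) = (\<Sum>n<t. f (g n))"
      by (simp_all add: card_image sum.reindex)
    moreover have "g ` {..<t} \<subseteq> {..<m}"
      using \<open>m > 0\<close> by (auto simp: g_def)
    ultimately show ?thesis
      using sum_lessThan_card_le[OF mono, of "g ` {..<t}"] by (simp add: g_def periodic)
  qed
  show ?case
  proof (cases "t \<le> m")
    case False
    then obtain s where t: "t = m + s"
      by (metis le_add_diff_inverse nat_le_linear)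
    have split: "(\<Sum>n<m + s. g n) = (\<Sum>n<m. g n) + (\<Sum>n<s. g (m + n))" for g :: "nat \<Rightarrow> int"
      by (induction s) (auto simp: add_ac)
    have "f (m + n) = f n" and "f (k * (m + n)) = f (k * n)" for n
      using periodic[of "m + n"] periodic[of n] periodic[of "k * (m + n)"] periodic[of "k * n"]
      by (simp_all add: distrib_left)
    thus ?thesis
      using short[of m] less.IH[of s] \<open>m > 0\<close> by (simp add: t split)
  qed (use short in auto)
qed

section \<open>Prime exponents of multinomial coefficients\<close>

text \<open>This is \<open>\<phi>(n/m)\<close>, with the floors written as natural division; the
  integer type keeps the subtraction from truncating.\<close>

definition floor_defect :: "nat list \<Rightarrow> nat \<Rightarrow> nat \<Rightarrow> int" where
  "floor_defect cs m n = int (sum_list cs * n div m) - (\<Sum>c\<leftarrow>cs. int (c * n div m))"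

text \<open>Removing \<open>q\<close> full periods from \<open>n\<close> lowers the floor for each
  \<open>c\<close> by \<open>c * q\<close> and the leading floor by the sum of these amounts, so the
  changes cancel.\<close>

lemma floor_defect_mod:
  assumes "m > 0"
  shows "floor_defect cs m (n mod m) = floor_defect cs m n"
proof -
  have "c * n div m = c * (n div m) + c * (n mod m) div m" for c
  proof -
    have "c * n = c * (n mod m) + c * (n div m) * m"
      by (metis add.commute div_mult_mod_eq distrib_left mult.assoc)
    thus ?thesis
      using assms by simp
  qed
  moreover have "(\<Sum>c\<leftarrow>cs. int (c * q)) = int (sum_list cs * q)" for q
    by (induction cs) (auto simp: distrib_right)
  ultimately show ?thesis
    by (simp add: floor_defect_def sum_list_addf)
qed

text \<open>For prime \<open>p\<close>, the exponent of \<open>p\<close> in the multinomial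
  coefficient with lower entries \<open>c * n\<close>, for \<open>c\<close> in
  \<open>cs\<close>.\<close>

definition multinomial_val :: "nat list \<Rightarrow> nat \<Rightarrow> nat \<Rightarrow> int" where
  "multinomial_val cs p n =
     int (multiplicity p (fact (sum_list cs * n) :: nat))
       - (\<Sum>c\<leftarrow>cs. int (multiplicity p (fact (c * n) :: nat)))"

lemma multinomial_val_eq_sum_floor_defect:
  assumes p: "prime p" and L: "sum_list cs * n \<le> L"
  shows "multinomial_val cs p n = (\<Sum>i=1..L. floor_defect cs (p ^ i) n)"
proof -
  have "(\<Sum>c\<leftarrow>cs. int (multiplicity p (fact (c * n) :: nat)))
          = (\<Sum>c\<leftarrow>cs. \<Sum>i=1..L. int (c * n div p ^ i))"
  proof (intro arg_cong[where f = sum_list] map_cong refl)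
    fix c assume "c \<in> set cs"
    hence "c * n \<le> sum_list cs * n"
      by (intro mult_le_mono1 member_le_sum_list) auto
    also note L
    finally have "c * n \<le> L" .
    thus "int (multiplicity p (fact (c * n) :: nat)) = (\<Sum>i=1..L. int (c * n div p ^ i))"
      using p by (simp add: multiplicity_fact_legendre)
  qed
  also have "\<dots> = (\<Sum>i=1..L. \<Sum>c\<leftarrow>cs. int (c * n div p ^ i))"
    by (induction cs) (simp_all add: sum.distrib)
  finally show ?thesis
    using p L unfolding multinomial_val_def floor_defect_def
    by (simp add: multiplicity_fact_legendre sum_subtractf)
qed

text \<open>The exponent for each lower entry grows by \<open>c * n\<close>, the one for the upper
  entry by \<open>sum_list cs * n\<close>, and these cancel.\<close>

lemma multinomial_val_prime_mult:
  assumes p: "prime p"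
  shows "multinomial_val cs p (p * n) = multinomial_val cs p n"
proof -
  have "multiplicity p (fact (c * (p * n)) :: nat) = c * n + multiplicity p (fact (c * n) :: nat)" for c
    using multiplicity_fact_prime_mult[OF p, of "c * n"] by (simp add: mult_ac)
  moreover have "(\<Sum>c\<leftarrow>cs. int (c * n)) = int (sum_list cs * n)"
    by (induction cs) (auto simp: distrib_right)
  ultimately show ?thesis
    by (simp add: multinomial_val_def sum_list_addf)
qed

text \<open>Strong induction on \<open>k\<close> strips its factors \<open>p\<close>. Once
  \<open>k\<close> is coprime to every \<open>p ^ i\<close>, the inequality holds for each power
  separately.\<close>

lemma sum_multinomial_val_le:
  assumes mono: "\<And>m. mono_on {..<m} (floor_defect cs m)" and p: "prime p" and "k > 0"
  shows "(\<Sum>n<t. multinomial_val cs p n) \<le> (\<Sum>n<t. multinomial_val cs p (k * n))"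
  using \<open>k > 0\<close>
proof (induction k rule: less_induct)
  case (less k)
  show ?case
  proof (cases "p dvd k")
    case True
    then obtain j where k: "k = p * j"
      by (rule dvdE)
    hence "j < k" "j > 0"
      using less.prems prime_gt_1_nat[OF p] by auto
    thus ?thesis
      using less.IH[of j] p by (simp add: k mult.assoc multinomial_val_prime_mult)
  next
    case False
    hence cop: "coprime k (p ^ i)" for i
      using p by (metis coprime_commute coprime_power_right_iff prime_imp_coprime)
    \<comment> \<open>A single range for all factorials on both sides makes the order of summation
      exchangeable.\<close>
    define L where "L = sum_list cs * (k * t)"
    have L: "sum_list cs * n \<le> L" "sum_list cs * (k * n) \<le> L" if "n < t" for n
    proof -
      show "sum_list cs * (k * n) \<le> L"
        unfolding L_def using that by (intro mult_le_mono) auto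
      moreover have "sum_list cs * n \<le> sum_list cs * (k * n)"
        using less.prems by (intro mult_le_mono) auto
      ultimately show "sum_list cs * n \<le> L"
        by (rule order_trans[rotated])
    qed
    have "(\<Sum>n<t. multinomial_val cs p n) = (\<Sum>n<t. \<Sum>i=1..L. floor_defect cs (p ^ i) n)"
      using p L by (intro sum.cong refl multinomial_val_eq_sum_floor_defect) auto
    also have "\<dots> = (\<Sum>i=1..L. \<Sum>n<t. floor_defect cs (p ^ i) n)"
      by (rule sum.swap)
    also have "\<dots> \<le> (\<Sum>i=1..L. \<Sum>n<t. floor_defect cs (p ^ i) (k * n))"
      using prime_gt_0_nat[OF p]
      by (intro sum_mono sum_periodic_mono_le[OF mono] floor_defect_mod cop) auto
    also have "\<dots> = (\<Sum>n<t. \<Sum>i=1..L. floor_defect cs (p ^ i) (k * n))"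
      by (rule sum.swap)
    also have "\<dots> = (\<Sum>n<t. multinomial_val cs p (k * n))"
      using p L by (intro sum.cong refl multinomial_val_eq_sum_floor_defect[symmetric]) auto
    finally show ?thesis .
  qed
qed

section \<open>Integrality by comparing prime exponents\<close>

lemma prod_multinomial_quotient_in_Ints:
  assumes mono: "\<And>m. mono_on {..<m} (floor_defect cs m)" and "k > 0"
  shows "(\<Prod>n=1..t. multinomial (map (\<lambda>c. c * (k * n)) cs))
           / (\<Prod>n=1..t. multinomial (map (\<lambda>c. c * n) cs)) \<in> \<int>"
proof -
  define num :: "nat \<Rightarrow> nat" where "num n = fact (sum_list cs * n)" for n
  define den :: "nat \<Rightarrow> nat" where "den n = (\<Prod>c\<leftarrow>cs. fact (c * n))" for n
  have num0: "num n \<noteq> 0" and den0: "den n \<noteq> 0" for n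
    by (auto simp: num_def den_def prod_list_zero_iff)
  have eq: "multinomial (map (\<lambda>c. c * n) cs) = of_nat (num n) / of_nat (den n)" for n
  proof -
    have "sum_list (map (\<lambda>c. c * n) cs) = sum_list cs * n"
      using sum_list_mult_const[of "\<lambda>c. c" n cs] by simp
    moreover have "(\<Prod>c\<leftarrow>cs. fact (c * n)) = (of_nat (den n) :: rat)"
    proof -
      have "(\<Prod>c\<leftarrow>xs. fact (c * n)) = (of_nat (\<Prod>c\<leftarrow>xs. fact (c * n)) :: rat)" for xs
        by (induction xs) (simp_all only: list.map prod_list.Nil prod_list.Cons of_nat_1 of_nat_mult of_nat_fact)
      thus ?thesis
        by (simp only: den_def)
    qed
    ultimately show ?thesis
      by (simp only: multinomial_def num_def map_map o_def of_nat_fact)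
  qed
  \<comment> \<open>Clearing denominators turns the claim into \<open>Y dvd X\<close> over the
    naturals, which is checked prime by prime.\<close>
  define X where "X = (\<Prod>n=1..t. num (k * n) * den n)"
  define Y where "Y = (\<Prod>n=1..t. num n * den (k * n))"
  have XY0: "X \<noteq> 0" "Y \<noteq> 0"
    by (auto simp: X_def Y_def num0 den0)
  have "Y dvd X"
  proof (rule multiplicity_le_imp_dvd)
    fix p :: nat assume p: "prime p"
    have val: "multinomial_val cs p n = int (multiplicity p (num n)) - int (multiplicity p (den n))" for n
    proof -
      have "multiplicity p (den n) = (\<Sum>c\<leftarrow>cs. multiplicity p (fact (c * n) :: nat))"
        unfolding den_def using p by (intro multiplicity_prod_list) auto
      moreover have "int (\<Sum>c\<leftarrow>cs. multiplicity p (fact (c * n) :: nat))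
                       = (\<Sum>c\<leftarrow>cs. int (multiplicity p (fact (c * n) :: nat)))"
        by (induction cs) auto
      ultimately show ?thesis
        by (simp add: multinomial_val_def num_def)
    qed
    have mult: "int (multiplicity p (\<Prod>n=1..t. f n * g n))
        = (\<Sum>n=1..t. int (multiplicity p (f n)) + int (multiplicity p (g n)))"
      if nz: "\<And>n. f n \<noteq> 0" "\<And>n. g n \<noteq> 0" for f g :: "nat \<Rightarrow> nat"
    proof -
      have "0 \<notin> (\<lambda>n. f n * g n) ` {1..t}"
      proof
        assume "0 \<in> (\<lambda>n. f n * g n) ` {1..t}"
        then obtain n where "0 = f n * g n"
          by (rule imageE)
        thus False
          using nz[of n] by simp
      qed
      hence "multiplicity p (\<Prod>n=1..t. f n * g n) = (\<Sum>n=1..t. multiplicity p (f n * g n))"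
        using p by (intro prime_elem_multiplicity_prod_distrib) auto
      moreover have "multiplicity p (f n * g n) = multiplicity p (f n) + multiplicity p (g n)" for n
        using p nz by (intro prime_elem_multiplicity_mult_distrib) auto
      ultimately show ?thesis
        by simp
    qed
    have "int (multiplicity p X) - int (multiplicity p Y)
        = (\<Sum>n=1..t. multinomial_val cs p (k * n)) - (\<Sum>n=1..t. multinomial_val cs p n)"
      unfolding X_def Y_def
      by (subst (1 2) mult) (auto simp: num0 den0 val sum_subtractf sum.distrib)
    \<comment> \<open>The added terms at \<open>n = 0\<close> agree because
      \<open>k * 0 = 0\<close>, so the difference is unchanged.\<close>
    also have "\<dots> = (\<Sum>n<Suc t. multinomial_val cs p (k * n)) - (\<Sum>n<Suc t. multinomial_val cs p n)"
      by (simp add: sum.lessThan_Suc_shift sum.atLeast1_atMost_eq del: sum.lessThan_Suc)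
    also have "\<dots> \<ge> 0"
      using sum_multinomial_val_le[OF mono p \<open>k > 0\<close>, of "Suc t"] by simp
    finally show "multiplicity p Y \<le> multiplicity p X"
      by simp
  qed (use XY0 in auto)
  moreover have "(\<Prod>n=1..t. multinomial (map (\<lambda>c. c * (k * n)) cs))
           / (\<Prod>n=1..t. multinomial (map (\<lambda>c. c * n) cs)) = of_nat X / of_nat Y"
    unfolding eq X_def Y_def by (simp add: prod_dividef prod.distrib)
  ultimately show ?thesis
    using XY0 by (auto elim!: dvdE)
qed

section \<open>Monotonicity in the three cases\<close>

text \<open>For \<open>n < m\<close> every subtracted floor \<open>n div m\<close> vanishes, leaving
  only \<open>l * n div m\<close>.\<close>

lemma mono_on_floor_defect_replicate: "mono_on {..<m} (floor_defect (replicate l 1) m)"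
proof (rule mono_onI)
  fix r s assume rs: "r \<in> {..<m}" "s \<in> {..<m}" "r \<le> s"
  have defect: "floor_defect (replicate l 1) m n = int (l * n div m)" if "n < m" for n
    using that by (simp add: floor_defect_def sum_list_replicate)
  have "l * r div m \<le> l * s div m"
    using rs by (intro div_le_mono mult_le_mono2)
  thus "floor_defect (replicate l 1) m r \<le> floor_defect (replicate l 1) m s"
    using rs defect[of r] defect[of s] by simp
qed

lemma mono_on_floor_defect_1_2_3: "mono_on {..<m} (floor_defect [1, 2, 3] m)"
proof (rule mono_onI)
  fix r s assume "r \<in> {..<m}" "s \<in> {..<m}" "r \<le> s"
  \<comment> \<open>All the floors are functions of \<open>\<lfloor>6 n / m\<rfloor> \<in> {0, \<dots>, 5}\<close>.\<close>
  define y where "y n = 6 * n div m" for n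
  have defect: "floor_defect [1, 2, 3] m n = int (y n) - int (y n div 3) - int (y n div 2)"
    if "n < m" for n
  proof -
    have "y n div 3 = 2 * n div m" "y n div 2 = 3 * n div m"
      unfolding y_def by (simp_all flip: div_mult2_eq add: mult.commute[of m])
    thus ?thesis
      using that by (simp add: floor_defect_def y_def)
  qed
  have lt: "y s < 6"
    unfolding y_def using \<open>s \<in> {..<m}\<close> by (simp add: div_less_iff_less_mult)
  have le: "y r \<le> y s"
    unfolding y_def using \<open>r \<le> s\<close> by (intro div_le_mono) simp
  \<comment> \<open>At 0, 1, 2, 3, 4, 5 the expression takes the values 0, 1, 1, 1, 1, 2.\<close>
  have "int a - int (a div 3) - int (a div 2) \<le> int b - int (b div 3) - int (b div 2)"
    if "a \<le> b" "b < 6" for a b :: nat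
  proof -
    have "a \<in> {0, 1, 2, 3, 4, 5}" "b \<in> {0, 1, 2, 3, 4, 5}"
      using that by auto
    thus ?thesis
      using \<open>a \<le> b\<close> by auto
  qed
  from this[OF le lt] show "floor_defect [1, 2, 3] m r \<le> floor_defect [1, 2, 3] m s"
    using defect[of r] defect[of s] \<open>r \<in> {..<m}\<close> \<open>s \<in> {..<m}\<close> by simp
qed

theorem corollary7:
  fixes k t :: nat
  assumes "k > 0" and "t > 0"
  shows "(\<Prod>n=1..t. of_nat ((2 * k * n) choose (k * n)))
           / (\<Prod>n=1..t. of_nat ((2 * n) choose n)) \<in> (\<int> :: rat set)
       \<and> (\<Prod>n=1..t. multinomial [k * n, k * n, k * n])
           / (\<Prod>n=1..t. multinomial [n, n, n]) \<in> \<int>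
       \<and> (\<Prod>n=1..t. multinomial [k * n, 2 * k * n, 3 * k * n])
           / (\<Prod>n=1..t. multinomial [n, 2 * n, 3 * n]) \<in> \<int>"
proof -
  have binomial: "of_nat ((2 * n) choose n) = multinomial [n, n]" for n
    by (simp add: multinomial_two mult_2)
  \<comment> \<open>The explicit list makes the general result match
    \<open>multinomial [n, n]\<close>, the central binomial coefficient.\<close>
  have "replicate 2 1 = [1, 1 :: nat]"
    by (simp add: numeral_2_eq_2)
  hence "(\<Prod>n=1..t. of_nat ((2 * k * n) choose (k * n)))
           / (\<Prod>n=1..t. of_nat ((2 * n) choose n)) \<in> (\<int> :: rat set)"
    using prod_multinomial_quotient_in_Ints[OF mono_on_floor_defect_replicate[of _ 2] \<open>k > 0\<close>, of t]
    by (simp add: binomial mult.assoc)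
  moreover have "(\<Prod>n=1..t. multinomial [k * n, k * n, k * n])
           / (\<Prod>n=1..t. multinomial [n, n, n]) \<in> \<int>"
    using prod_multinomial_quotient_in_Ints[OF mono_on_floor_defect_replicate[of _ 3] \<open>k > 0\<close>, of t]
    by (simp add: numeral_3_eq_3)
  moreover have "(\<Prod>n=1..t. multinomial [k * n, 2 * k * n, 3 * k * n])
           / (\<Prod>n=1..t. multinomial [n, 2 * n, 3 * n]) \<in> \<int>"
    using prod_multinomial_quotient_in_Ints[OF mono_on_floor_defect_1_2_3 \<open>k > 0\<close>, of t]
    by (simp add: mult.assoc)
  ultimately show ?thesis
    by blast
qed

end
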